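(* Let $C^*$ be the optimal classifier for the discriminator's self-supervised task $\Psi(C)$. At the equilibrium point, maximizing the generator's self-supervised task $\Phi(G,C^* )$ (over the generator $G$) is equal to maximizing $$\Phi(G,C^* ) = \frac{1}{K}\sum_{k=1}^{K}\left[\mathbb{E}_{\mathbf{x}\sim P_g^{T_k}}\log\left(\frac{p_d^{T_k}(\mathbf{x})}{\sum_{j=1}^{K}p_d^{T_j}(\mathbf{x})}\right)\right] = \frac{1}{K}\sum_{k=1}^{K}\mathcal{V}_{\Phi}^{T_k}(\mathbf{x}),$$ where $\mathcal{V}_{\Phi}^{T_k}(\mathbf{x})$ denotes the $k$-th bracketed term.
   Context: $\mathcal{T}=\{T_1,\dots,T_K\}$ is a set of image transformations, each applied with equal probability $p(T_k)=1/K$ (concretely $K=4$ and $T_1,\dots,T_4$ are image rotations by $0,90,180,270$ degrees). $P_d$ is the distribution of real data and $P_g$ the distribution induced by the generator $G$. For $\bullet\in\{d,g\}$, $P_\bullet^{T_k}$ is the distribution of samples of $P_\bullet$ transformed by $T_k$, with probability density $p_\bullet^{T_k}(\mathbf{x})$, and $P_\bullet^T$ is the mixture distribution of the transformed samples (over $T_k\in\mathcal{T}$), with density $p_\bullet^T(\mathbf{x})$. A classifier $C$ has softmax outputs $C_1(\mathbf{x}),\dots,C_K(\mathbf{x})$ with $\sum_{k=1}^K C_k(\mathbf{x})=1$ for all $\mathbf{x}$. A GAN with discriminator $D$, generator $G$ and classifier $C$ is trained with the objectives $$\max_{D,C}\ \mathcal{V}(D,G)+\lambda_d\Psi(C),\qquad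 \min_G\ \mathcal{V}(D,G)-\lambda_g\Phi(G,C),$$ where $\lambda_d,\lambda_g$ are constants and $\mathcal{V}(D,G)$ is the GAN value function, e.g. $\mathbb{E}_{\mathbf{x}\sim P_d}\log D(\mathbf{x})+\mathbb{E}_{\mathbf{x}\sim P_g}\log(1-D(\mathbf{x}))$ or an improved version of it. The self-supervised tasks are $$\Psi(C)=\mathbb{E}_{\mathbf{x}\sim P_d^T}\mathbb{E}_{T_k\sim\mathcal{T}}\log C_k(\mathbf{x}),\qquad \Phi(G,C)=\mathbb{E}_{\mathbf{x}\sim P_g^T}\mathbb{E}_{T_k\sim\mathcal{T}}\log C_k(\mathbf{x}).$$ Here $\mathbb{E}_{\mathbf{x}\sim P_\bullet^T}\mathbb{E}_{T_k\sim\mathcal{T}}\log C_k(\mathbf{x})$ means $\int p_\bullet^T(\mathbf{x})\sum_{k=1}^K p(T_k\mid\mathbf{x})\log C_k(\mathbf{x})\,d\mathbf{x}$, with $p(T_k\mid\mathbf{x})$ the probability that the sample $\mathbf{x}$ of the mixture belongs to class $T_k$ (i.e. that $T_k$ is the transformation applied to obtain it). All networks $D,G,C$ are assumed to have enough capacity; $D^*$ and $C^*$ denote the optimal discriminator and optimal classifier at an equilibrium point, and an optimal $D^*$ of the GAN task is assumed given.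
   Formalization: The generator is restricted to those whose transformed samples almost surely avoid points where all transformed data densities vanish; at such points the ratio is 0/0 and the optimal classifier is undetermined. *)

theory Defs
  imports "HOL-Probability.Probability"
begin

(* Images are vectors in a Euclidean space, densities are taken with respect to Lebesgue
   measure, and the transformations T 1, ..., T K are arbitrary Borel maps. *)

definition transformed :: "(nat \<Rightarrow> 'a \<Rightarrow> 'a) \<Rightarrow> 'a::euclidean_space measure \<Rightarrow> nat \<Rightarrow> 'a measure" where
  "transformed T P k = distr P lborel (T k)"

(* Law of T k x for x drawn from P and, independently, k drawn uniformly from {1..K}. *)
definition mixture :: "nat \<Rightarrow> (nat \<Rightarrow> 'a \<Rightarrow> 'a) \<Rightarrow> 'a::euclidean_space measure \<Rightarrow> 'a measure" where
  "mixture K T P = distr (uniform_count_measure {1..K} \<Otimes>\<^sub>M P) lborel (\<lambda>(k, x). T k x)"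

definition has_pdf :: "'a::euclidean_space measure \<Rightarrow> bool" where
  "has_pdf M \<longleftrightarrow> (\<exists>f. distributed M lborel (\<lambda>x. x) f)"

(* A fixed version of the density; meaningful only under has_pdf M. *)
definition pdf :: "'a::euclidean_space measure \<Rightarrow> 'a \<Rightarrow> real" where
  "pdf M x = enn2real (RN_deriv lborel M x)"

(* The probability p(T_k | x) that x, sampled from the mixture, was produced by T k:
   Bayes' formula with prior p(T_k) = 1 / K. Its value where the mixture density vanishes
   is irrelevant, as it is only ever weighted by that density. *)
definition posterior :: "nat \<Rightarrow> (nat \<Rightarrow> 'a \<Rightarrow> 'a) \<Rightarrow> 'a::euclidean_space measure \<Rightarrow> nat \<Rightarrow> 'a \<Rightarrow> real" where
  "posterior K T P k x = (1 / real K) * pdf (transformed T P k) x / pdf (mixture K T P) x"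

(* The library has ln 0 = 0, which would reward a classifier for outputting 0. *)
definition elog :: "real \<Rightarrow> ereal" where
  "elog x = (if 0 < x then ereal (ln x) else -\<infinity>)"

(* Extended-real integral. It is used only for nonpositive integrands, so
   the ill-defined difference \<infinity> - \<infinity> does not occur. *)
definition eintegral :: "'a measure \<Rightarrow> ('a \<Rightarrow> ereal) \<Rightarrow> ereal" where
  "eintegral M f = enn2ereal (\<integral>\<^sup>+ x. e2ennreal (f x) \<partial>M) - enn2ereal (\<integral>\<^sup>+ x. e2ennreal (- f x) \<partial>M)"

(* Zero outputs are allowed (limits of softmax outputs), since the optimal classifier can
   need them when some transformed densities vanish. *)
definition classifier :: "nat \<Rightarrow> (nat \<Rightarrow> 'a::euclidean_space \<Rightarrow> real) \<Rightarrow> bool" where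
  "classifier K C \<longleftrightarrow>
     (\<forall>k\<in>{1..K}. C k \<in> borel_measurable borel \<and> (\<forall>x. 0 \<le> C k x)) \<and>
     (\<forall>x. (\<Sum>k=1..K. C k x) = 1)"

definition ss_task ::
  "nat \<Rightarrow> (nat \<Rightarrow> 'a \<Rightarrow> 'a) \<Rightarrow> 'a::euclidean_space measure \<Rightarrow> (nat \<Rightarrow> 'a \<Rightarrow> real) \<Rightarrow> ereal" where
  "ss_task K T P C =
     eintegral lborel (\<lambda>x. ereal (pdf (mixture K T P) x) *
       (\<Sum>k=1..K. ereal (posterior K T P k x) * elog (C k x)))"

definition Psi ::
  "nat \<Rightarrow> (nat \<Rightarrow> 'a \<Rightarrow> 'a) \<Rightarrow> 'a::euclidean_space measure \<Rightarrow> (nat \<Rightarrow> 'a \<Rightarrow> real) \<Rightarrow> ereal" where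
  "Psi K T Pd C = ss_task K T Pd C"

(* A generator is a map G from a latent probability space Z to images. *)
definition generated :: "'z measure \<Rightarrow> ('z \<Rightarrow> 'a) \<Rightarrow> 'a::euclidean_space measure" where
  "generated Z G = distr Z borel G"

definition Phi ::
  "nat \<Rightarrow> (nat \<Rightarrow> 'a \<Rightarrow> 'a) \<Rightarrow> 'z measure \<Rightarrow> ('z \<Rightarrow> 'a::euclidean_space) \<Rightarrow> (nat \<Rightarrow> 'a \<Rightarrow> real) \<Rightarrow> ereal" where
  "Phi K T Z G C = ss_task K T (generated Z G) C"

definition optimal_classifier ::
  "nat \<Rightarrow> (nat \<Rightarrow> 'a \<Rightarrow> 'a) \<Rightarrow> 'a::euclidean_space measure \<Rightarrow> (nat \<Rightarrow> 'a \<Rightarrow> real) \<Rightarrow> bool" where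
  "optimal_classifier K T Pd C \<longleftrightarrow> is_arg_max (Psi K T Pd) (classifier K) C"

(* The absolute continuity says that generated samples almost surely avoid the set where all
   the densities of the transformed data vanish. On that set the data leave the optimal
   classifier undetermined, and the ratio in V_Phi is 0 / 0. *)
definition admissible_generator ::
  "nat \<Rightarrow> (nat \<Rightarrow> 'a \<Rightarrow> 'a) \<Rightarrow> 'a::euclidean_space measure \<Rightarrow> 'z measure \<Rightarrow> ('z \<Rightarrow> 'a) \<Rightarrow> bool" where
  "admissible_generator K T Pd Z G \<longleftrightarrow>
     G \<in> measurable Z borel \<and>
     (\<forall>k\<in>{1..K}. has_pdf (transformed T (generated Z G) k)) \<and>
     absolutely_continuous (mixture K T Pd) (mixture K T (generated Z G))"

definition V_Phi ::
  "nat \<Rightarrow> (nat \<Rightarrow> 'a \<Rightarrow> 'a) \<Rightarrow> 'a::euclidean_space measure \<Rightarrow> 'z measure \<Rightarrow> ('z \<Rightarrow> 'a) \<Rightarrow> nat \<Rightarrow> ereal" where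
  "V_Phi K T Pd Z G k =
     eintegral (transformed T (generated Z G) k)
       (\<lambda>x. elog (pdf (transformed T Pd k) x / (\<Sum>j=1..K. pdf (transformed T Pd j) x)))"

(* Equilibrium of the two training objectives: V is an arbitrary GAN value function, Ds and Gs
   are the admitted discriminators and generators. *)
definition equilibrium ::
  "nat \<Rightarrow> (nat \<Rightarrow> 'a \<Rightarrow> 'a) \<Rightarrow> 'a::euclidean_space measure \<Rightarrow> 'z measure \<Rightarrow>
   ('d \<Rightarrow> ('z \<Rightarrow> 'a) \<Rightarrow> real) \<Rightarrow> real \<Rightarrow> real \<Rightarrow> 'd set \<Rightarrow> ('z \<Rightarrow> 'a) set \<Rightarrow>
   'd \<Rightarrow> (nat \<Rightarrow> 'a \<Rightarrow> real) \<Rightarrow> ('z \<Rightarrow> 'a) \<Rightarrow> bool" where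
  "equilibrium K T Pd Z V ld lg Ds Gs D C G \<longleftrightarrow>
     is_arg_max (\<lambda>(D', C'). ereal (V D' G) + ereal ld * Psi K T Pd C')
       (\<lambda>(D', C'). D' \<in> Ds \<and> classifier K C') (D, C) \<and>
     is_arg_min (\<lambda>G'. ereal (V D G') - ereal lg * Phi K T Z G' C) (\<lambda>G'. G' \<in> Gs) G"

(* So a result about optimal classifiers applies in particular at every equilibrium point. *)
lemma equilibrium_optimal_classifier:
  assumes "equilibrium K T Pd Z V ld lg Ds Gs D C G" and "0 < ld"
  shows "optimal_classifier K T Pd C"
proof -
  have C: "classifier K C"
    using assms(1) unfolding equilibrium_def is_arg_max_def by auto
  have le: "ereal (V D G) + ereal ld * Psi K T Pd C' \<le> ereal (V D G) + ereal ld * Psi K T Pd C"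
      if "classifier K C'" for C'
    using assms(1) that unfolding equilibrium_def is_arg_max_def
    by (auto simp: not_less)
  have "Psi K T Pd C' \<le> Psi K T Pd C" if "classifier K C'" for C'
    using le[OF that] assms(2)
    by (cases "Psi K T Pd C'"; cases "Psi K T Pd C") auto
  with C show ?thesis
    unfolding optimal_classifier_def is_arg_max_def by (auto simp: not_less)
qed

end

(* Write q_k for the density of the data transformed by T_k and s = q_1 + ... + q_K. Up to the
   factor -1/K, Psi(C) is the integral of the pointwise cross entropies of q(x) and C(x), and by
   Gibbs' inequality each of them is minimal at C_k(x) = q_k(x)/s(x), uniquely where s(x) > 0.
   This minimum has a finite integral, since it lies below the loss of the uniform classifier, so
   an optimal classifier agrees with q_k/s almost everywhere on the support of the data mixture.
   Absolute continuity transfers the identity to the generated samples, where Phi(G, C) is the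
   mean over k of the expectations of log C_k under the transformed generated distributions. *)

theory Submission
  imports Defs
begin

(* Valued in ennreal, where 0 * \<infinity> = 0, so that all tasks become nonnegative integrals. *)
definition nlog :: "real \<Rightarrow> ennreal" where
  "nlog x = e2ennreal (- elog x)"

section \<open>Logarithmic losses as nonnegative extended reals\<close>

lemma nlog_pos: "0 < x \<Longrightarrow> nlog x = ennreal (- ln x)"
  by (simp add: nlog_def elog_def ennreal.abs_eq e2ennreal_ereal)

lemma nlog_nonpos: "x \<le> 0 \<Longrightarrow> nlog x = \<infinity>"
  by (simp add: nlog_def elog_def infinity_ennreal_def)

lemma nlog_measurable [measurable]: "nlog \<in> borel_measurable borel"
  unfolding nlog_def elog_def by measurable

text \<open>\<open>e2ennreal\<close> truncates negative values to 0, so the bound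
  \<open>x \<le> 1\<close> is what lets \<open>- elog x\<close> survive the passage through
  \<open>ennreal\<close>.\<close>

lemma elog_eq_nlog:
  assumes "x \<le> 1"
  shows "elog x = - enn2ereal (nlog x)"
proof -
  have "0 \<le> - elog x" using assms by (simp add: elog_def)
  then show ?thesis unfolding nlog_def by (simp add: enn2ereal_e2ennreal)
qed

lemma mult_uminus_enn2ereal:
  assumes "0 \<le> a"
  shows "ereal a * - enn2ereal x = - enn2ereal (ennreal a * x)"
  using assms by (simp add: times_ennreal.rep_eq enn2ereal_ennreal)

lemma sum_uminus_enn2ereal:
  "(\<Sum>k\<in>I. - enn2ereal (f k)) = - enn2ereal (\<Sum>k\<in>I. f k)"
proof (induction I rule: infinite_finite_induct)
  case (insert k I)
  have "- enn2ereal x + - enn2ereal y = - enn2ereal (x + y)" for x y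
    unfolding plus_ennreal.rep_eq
    by (cases "enn2ereal x"; cases "enn2ereal y"; use enn2ereal_nonneg[of x] enn2ereal_nonneg[of y] in simp)
  with insert show ?case by simp
qed (simp_all add: zero_ennreal.rep_eq)

text \<open>The positive part of the integrand is truncated to 0, which leaves only the subtracted
  integral of \<open>eintegral\<close>.\<close>

lemma eintegral_uminus_enn2ereal:
  "eintegral M (\<lambda>x. - enn2ereal (f x)) = - enn2ereal (\<integral>\<^sup>+ x. f x \<partial>M)"
proof -
  have "e2ennreal (- enn2ereal y) = 0" for y
    by (simp add: e2ennreal_neg)
  then show ?thesis
    unfolding eintegral_def by (simp add: zero_ennreal.rep_eq)
qed

lemma eintegral_cong_AE:
  assumes "AE x in M. f x = g x"
  shows "eintegral M f = eintegral M g"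
proof -
  have "(\<integral>\<^sup>+ x. e2ennreal (f x) \<partial>M) = (\<integral>\<^sup>+ x. e2ennreal (g x) \<partial>M)"
    "(\<integral>\<^sup>+ x. e2ennreal (- f x) \<partial>M) = (\<integral>\<^sup>+ x. e2ennreal (- g x) \<partial>M)"
    using assms by (auto intro!: nn_integral_cong_AE)
  then show ?thesis unfolding eintegral_def by simp
qed

section \<open>Densities with respect to Lebesgue measure\<close>

lemma pdf_nonneg: "0 \<le> pdf M x"
  by (simp add: pdf_def)

lemma pdf_measurable [measurable]: "pdf M \<in> borel_measurable borel"
proof -
  have "RN_deriv lborel M \<in> borel_measurable lborel" by simp
  then show ?thesis unfolding pdf_def by simp
qed

text \<open>\<open>has_pdf\<close> makes \<open>M\<close> absolutely continuous, so Radon-Nikodym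
  applies. Finiteness of \<open>M\<close> makes the derivative finite almost everywhere, so
  \<open>enn2real\<close> in \<open>pdf\<close> loses nothing.\<close>

lemma density_pdf:
  assumes "has_pdf M" "finite_measure M" "sets M = sets borel"
  shows "density lborel (\<lambda>x. ennreal (pdf M x)) = M"
proof -
  interpret finite_measure M by fact
  obtain f where f: "distributed M lborel (\<lambda>x. x) f"
    using assms(1) by (auto simp: has_pdf_def)
  \<comment> \<open>\<open>lborel\<close> and \<open>M\<close> have the same measurable sets, so the
    identity pushes \<open>M\<close> forward to itself.\<close>
  have "distr M lborel (\<lambda>x. x) = distr M M (\<lambda>x. x)"
    using assms(3) by (intro distr_cong) auto
  then have "M = density lborel f"
    using f by (simp add: distributed_def distr_id)
  then have ac: "absolutely_continuous lborel M"
    using f by (simp add: distributed_def absolutely_continuousI_density)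
  have "AE x in lborel. RN_deriv lborel M x \<noteq> \<infinity>"
    using sigma_finite_measure_axioms ac assms(3)
    by (intro sigma_finite_measure.RN_deriv_finite[OF lborel.sigma_finite_measure_axioms]) auto
  then have "AE x in lborel. ennreal (pdf M x) = RN_deriv lborel M x"
    by eventually_elim (simp add: pdf_def less_top)
  then have "density lborel (\<lambda>x. ennreal (pdf M x)) = density lborel (RN_deriv lborel M)"
    by (intro density_cong) auto
  also have "\<dots> = M"
    using ac assms(3) by (intro sigma_finite_measure.density_RN_deriv[OF lborel.sigma_finite_measure_axioms]) auto
  finally show ?thesis .
qed

lemma pdf_unique:
  assumes "f \<in> borel_measurable borel" "\<And>x. 0 \<le> f x"
    and "density lborel (\<lambda>x. ennreal (f x)) = M"
  shows "AE x in lborel. pdf M x = f x"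
proof -
  have "AE x in lborel. ennreal (f x) = RN_deriv lborel M x"
    using assms by (intro sigma_finite_measure.RN_deriv_unique[OF lborel.sigma_finite_measure_axioms]) auto
  then show ?thesis
    by eventually_elim (metis pdf_def enn2real_ennreal assms(2))
qed

lemma classifier_le_1:
  assumes "classifier K C" "k \<in> {1..K}"
  shows "C k x \<le> 1"
proof -
  have "C k x \<le> (\<Sum>k=1..K. C k x)"
    using assms by (intro member_le_sum) (auto simp: classifier_def)
  then show ?thesis using assms by (simp add: classifier_def)
qed

section \<open>The mixture of transformed samples and its task\<close>

text \<open>Serves both the real data distribution and the generated one.\<close>

locale transformed_mixture =
  fixes K :: nat and T :: "nat \<Rightarrow> 'a::euclidean_space \<Rightarrow> 'a" and P :: "'a measure"
  assumes K: "1 \<le> K"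
    and T [measurable]: "\<And>k. k \<in> {1..K} \<Longrightarrow> T k \<in> measurable borel borel"
    and P: "prob_space P" and sets_P [simp, measurable_cong]: "sets P = sets borel"
    and pdf: "\<And>k. k \<in> {1..K} \<Longrightarrow> has_pdf (transformed T P k)"
begin

sublocale prob_space P by (fact P)

abbreviation q :: "nat \<Rightarrow> 'a \<Rightarrow> real" where
  "q k \<equiv> pdf (transformed T P k)"

lemma transformed_prob_space: "k \<in> {1..K} \<Longrightarrow> prob_space (transformed T P k)"
  unfolding transformed_def by (intro prob_space_distr) simp

lemma density_q:
  assumes "k \<in> {1..K}"
  shows "density lborel (\<lambda>x. ennreal (q k x)) = transformed T P k"
  using assms transformed_prob_space[OF assms]
  by (intro density_pdf pdf) (auto simp: prob_space_def transformed_def)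

lemma nn_integral_transformed:
  assumes "k \<in> {1..K}" "f \<in> borel_measurable borel"
  shows "(\<integral>\<^sup>+ x. f x \<partial>transformed T P k) = (\<integral>\<^sup>+ x. ennreal (q k x) * f x \<partial>lborel)"
  using assms by (subst density_q[symmetric]) (auto simp: nn_integral_density)

text \<open>Fubini on the product of the uniform index measure, whose atoms have mass
  \<open>1 / real K\<close>, with \<open>P\<close>.\<close>

lemma nn_integral_mixture:
  assumes f [measurable]: "f \<in> borel_measurable borel"
  shows "(\<integral>\<^sup>+ x. f x \<partial>mixture K T P) =
    (\<Sum>k=1..K. ennreal (1 / real K) * (\<integral>\<^sup>+ x. f x \<partial>transformed T P k))"
proof -
  let ?U = "uniform_count_measure {1..K}"
  have sets_U: "sets ?U = sets (count_space {1..K})"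
    by (simp add: sets_uniform_count_measure)
  \<comment> \<open>The index set is countable, so joint measurability reduces to that of each
    \<open>T k\<close>.\<close>
  have "(\<lambda>(k, x). T k x) \<in> count_space {1..K} \<Otimes>\<^sub>M P \<rightarrow>\<^sub>M lborel"
    by (rule measurable_pair_measure_countable1) auto
  then have m [measurable]: "(\<lambda>(k, x). T k x) \<in> ?U \<Otimes>\<^sub>M P \<rightarrow>\<^sub>M lborel"
    using measurable_cong_sets[OF sets_pair_measure_cong[OF sets_U refl] refl] by blast
  have "(\<integral>\<^sup>+ x. f x \<partial>mixture K T P) = (\<integral>\<^sup>+ z. f (case z of (k, x) \<Rightarrow> T k x) \<partial>(?U \<Otimes>\<^sub>M P))"
    unfolding mixture_def using m by (intro nn_integral_distr) simp_all
  also have "\<dots> = (\<integral>\<^sup>+ k. (\<integral>\<^sup>+ x. f (T k x) \<partial>P) \<partial>?U)"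
    using nn_integral_fst[OF measurable_compose[OF m, of f]] by simp
  also have "\<dots> = (\<Sum>k=1..K. ennreal (1 / real K) * (\<integral>\<^sup>+ x. f (T k x) \<partial>P))"
    unfolding uniform_count_measure_def
    by (subst nn_integral_point_measure_finite) (auto simp: mult.commute)
  also have "\<dots> = (\<Sum>k=1..K. ennreal (1 / real K) * (\<integral>\<^sup>+ x. f x \<partial>transformed T P k))"
    by (intro sum.cong refl) (simp add: transformed_def nn_integral_distr)
  finally show ?thesis .
qed

lemma density_mixture:
  "density lborel (\<lambda>x. ennreal ((\<Sum>k=1..K. q k x) / real K)) = mixture K T P"
proof (rule measure_eqI)
  show "sets (density lborel (\<lambda>x. ennreal ((\<Sum>k=1..K. q k x) / real K))) = sets (mixture K T P)"
    by (simp add: mixture_def)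
next
  fix A assume "A \<in> sets (density lborel (\<lambda>x. ennreal ((\<Sum>k=1..K. q k x) / real K)))"
  then have A [measurable]: "A \<in> sets borel" by simp
  have eq: "ennreal ((\<Sum>k=1..K. q k x) / real K) * indicator A x =
      (\<Sum>k=1..K. ennreal (1 / real K) * (ennreal (q k x) * indicator A x))" for x
  proof -
    have "ennreal ((\<Sum>k=1..K. q k x) / real K) = ennreal (1 / real K) * (\<Sum>k=1..K. ennreal (q k x))"
      by (simp add: pdf_nonneg sum_nonneg flip: ennreal_mult)
    then show ?thesis by (simp add: sum_distrib_left sum_distrib_right mult.assoc)
  qed
  have "emeasure (mixture K T P) A = (\<integral>\<^sup>+ x. indicator A x \<partial>mixture K T P)"
    by (rule nn_integral_indicator[symmetric]) (simp add: mixture_def)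
  also have "\<dots> = (\<Sum>k=1..K. ennreal (1 / real K) * (\<integral>\<^sup>+ x. ennreal (q k x) * indicator A x \<partial>lborel))"
    by (subst nn_integral_mixture) (auto simp: nn_integral_transformed)
  also have "\<dots> = (\<integral>\<^sup>+ x. ennreal ((\<Sum>k=1..K. q k x) / real K) * indicator A x \<partial>lborel)"
    unfolding eq by (subst nn_integral_sum) (auto simp: nn_integral_cmult)
  finally show "emeasure (density lborel (\<lambda>x. ennreal ((\<Sum>k=1..K. q k x) / real K))) A =
      emeasure (mixture K T P) A"
    by (simp add: emeasure_density)
qed

lemma pdf_mixture: "AE x in lborel. pdf (mixture K T P) x = (\<Sum>k=1..K. q k x) / real K"
  by (rule pdf_unique[OF _ _ density_mixture]) (auto intro!: divide_nonneg_nonneg sum_nonneg pdf_nonneg)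

text \<open>Since \<open>q k\<close> is at most the sum of all \<open>q j\<close>, it can be
  positive only where the mixture density is.\<close>

lemma AE_transformed_of_mixture:
  assumes "AE x in mixture K T P. R x" "k \<in> {1..K}"
  shows "AE x in transformed T P k. R x"
proof -
  have "AE x in lborel. ennreal ((\<Sum>k=1..K. q k x) / real K) > 0 \<longrightarrow> R x"
    using assms(1) by (subst (asm) density_mixture[symmetric]) (simp add: AE_density)
  then have "AE x in lborel. ennreal (q k x) > 0 \<longrightarrow> R x"
  proof eventually_elim
    case (elim x)
    have "q k x \<le> (\<Sum>k=1..K. q k x)"
      using assms(2) by (intro member_le_sum) (auto simp: pdf_nonneg)
    with elim K show ?case by (auto simp: ennreal_less_zero_iff)
  qed
  then show ?thesis
    using assms(2) by (subst density_q[symmetric]) (simp_all add: AE_density)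
qed

text \<open>The mixture density cancels the denominator of Bayes' formula and leaves the weights
  \<open>q k x / K\<close>.\<close>

lemma ss_task_eq_lborel:
  assumes "classifier K C"
  shows "ss_task K T P C =
    - enn2ereal (\<integral>\<^sup>+ x. ennreal (1 / real K) * (\<Sum>k=1..K. ennreal (q k x) * nlog (C k x)) \<partial>lborel)"
proof -
  have "AE x in lborel. ereal (pdf (mixture K T P) x) *
      (\<Sum>k=1..K. ereal (posterior K T P k x) * elog (C k x)) =
      - enn2ereal (ennreal (1 / real K) * (\<Sum>k=1..K. ennreal (q k x) * nlog (C k x)))"
    using pdf_mixture
  proof eventually_elim
    case (elim x)
    let ?m = "pdf (mixture K T P) x"
    have post: "0 \<le> posterior K T P k x" for k
      by (simp add: posterior_def pdf_nonneg)
    have mpost: "?m * posterior K T P k x = 1 / real K * q k x" if "k \<in> {1..K}" for k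
    proof (cases "?m = 0")
      case True
      then have "(\<Sum>k=1..K. q k x) = 0" using elim K by simp
      then have "q k x = 0" using that by (subst (asm) sum_nonneg_eq_0_iff) (auto simp: pdf_nonneg)
      then show ?thesis using True by simp
    qed (simp add: posterior_def)
    have "(\<Sum>k=1..K. ereal (posterior K T P k x) * elog (C k x)) =
        - enn2ereal (\<Sum>k=1..K. ennreal (posterior K T P k x) * nlog (C k x))"
      unfolding sum_uminus_enn2ereal[symmetric]
      by (intro sum.cong refl) (simp only: elog_eq_nlog[OF classifier_le_1[OF assms]] mult_uminus_enn2ereal[OF post])
    then have "ereal ?m * (\<Sum>k=1..K. ereal (posterior K T P k x) * elog (C k x)) =
        - enn2ereal (ennreal ?m * (\<Sum>k=1..K. ennreal (posterior K T P k x) * nlog (C k x)))"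
      by (simp only: mult_uminus_enn2ereal[OF pdf_nonneg])
    also have "ennreal ?m * (\<Sum>k=1..K. ennreal (posterior K T P k x) * nlog (C k x)) =
        (\<Sum>k=1..K. ennreal (?m * posterior K T P k x) * nlog (C k x))"
      by (simp add: sum_distrib_left ennreal_mult pdf_nonneg post mult.assoc)
    also have "\<dots> = (\<Sum>k=1..K. ennreal (1 / real K * q k x) * nlog (C k x))"
      by (intro sum.cong refl) (simp only: mpost)
    also have "\<dots> = ennreal (1 / real K) * (\<Sum>k=1..K. ennreal (q k x) * nlog (C k x))"
      unfolding sum_distrib_left
      by (intro sum.cong refl) (simp only: ennreal_mult pdf_nonneg mult.assoc divide_nonneg_nonneg of_nat_0_le_iff zero_le_one)
    finally show ?case .
  qed
  then show ?thesis
    unfolding ss_task_def by (simp add: eintegral_cong_AE eintegral_uminus_enn2ereal)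
qed

text \<open>Weighting by \<open>q k\<close> is integrating against the law of the samples
  transformed by \<open>T k\<close>; this is the form that matches the sum of the
  \<open>V_Phi\<close> terms.\<close>

lemma ss_task_eq_transformed:
  assumes "classifier K C"
  shows "ss_task K T P C =
    - enn2ereal (ennreal (1 / real K) * (\<Sum>k=1..K. \<integral>\<^sup>+ x. nlog (C k x) \<partial>transformed T P k))"
proof -
  have C [measurable]: "C k \<in> borel_measurable borel" if "k \<in> {1..K}" for k
    using assms that by (simp add: classifier_def)
  have m: "(\<lambda>x. ennreal (q k x) * nlog (C k x)) \<in> borel_measurable lborel" if "k \<in> {1..K}" for k
    using that by measurable
  have "(\<integral>\<^sup>+ x. ennreal (1 / real K) * (\<Sum>k=1..K. ennreal (q k x) * nlog (C k x)) \<partial>lborel) =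
      ennreal (1 / real K) * (\<Sum>k=1..K. \<integral>\<^sup>+ x. ennreal (q k x) * nlog (C k x) \<partial>lborel)"
    by (simp only: nn_integral_cmult[OF borel_measurable_sum[OF m]] nn_integral_sum[OF m])
  also have "(\<Sum>k=1..K. \<integral>\<^sup>+ x. ennreal (q k x) * nlog (C k x) \<partial>lborel) =
      (\<Sum>k=1..K. \<integral>\<^sup>+ x. nlog (C k x) \<partial>transformed T P k)"
    by (intro sum.cong refl) (simp add: nn_integral_transformed)
  finally show ?thesis using ss_task_eq_lborel[OF assms] by simp
qed

end

section \<open>Gibbs' inequality with its equality case\<close>

text \<open>An infinite \<open>nlog (c k)\<close> can occur only with weight 0, and 0 times infinity
  is 0 in \<open>ennreal\<close>. The cross entropy is thus a finite real number, open to real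
  arithmetic.\<close>

lemma sum_nlog_eq:
  fixes q c :: "'i \<Rightarrow> real"
  assumes "\<And>k. k \<in> I \<Longrightarrow> 0 \<le> q k" "\<And>k. k \<in> I \<Longrightarrow> c k \<le> 1"
    and "\<And>k. k \<in> I \<Longrightarrow> 0 < q k \<Longrightarrow> 0 < c k"
  shows "(\<Sum>k\<in>I. ennreal (q k) * nlog (c k)) = ennreal (\<Sum>k\<in>I. q k * - ln (c k))"
    and "0 \<le> (\<Sum>k\<in>I. q k * - ln (c k))"
proof -
  have nonneg: "0 \<le> q k * - ln (c k)" if "k \<in> I" for k
  proof (cases "q k = 0")
    case False
    with assms[OF that] show ?thesis by (intro mult_nonneg_nonneg) auto
  qed simp
  have "(\<Sum>k\<in>I. ennreal (q k) * nlog (c k)) = (\<Sum>k\<in>I. ennreal (q k * - ln (c k)))"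
  proof (intro sum.cong refl)
    fix k assume k: "k \<in> I"
    show "ennreal (q k) * nlog (c k) = ennreal (q k * - ln (c k))"
    proof (cases "q k = 0")
      case False
      with assms[OF k] have "0 < q k" "0 < c k" by auto
      then show ?thesis using assms(2)[OF k] by (simp add: nlog_pos flip: ennreal_mult)
    qed simp
  qed
  with nonneg show "(\<Sum>k\<in>I. ennreal (q k) * nlog (c k)) = ennreal (\<Sum>k\<in>I. q k * - ln (c k))"
    by (simp only: sum_ennreal)
  show "0 \<le> (\<Sum>k\<in>I. q k * - ln (c k))" using nonneg by (rule sum_nonneg)
qed

text \<open>Each term is compared through \<open>ln r \<le> r - 1\<close>, where \<open>r\<close> is
  the ratio of \<open>c k\<close> to \<open>q k / s\<close>. The linear bounds sum to 0 because both
  sides are probability vectors, and equality in the sum forces \<open>r = 1\<close> wherever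
  \<open>q k > 0\<close>.\<close>

lemma gibbs:
  fixes q c :: "'i \<Rightarrow> real"
  assumes I: "finite I" and q: "\<And>k. k \<in> I \<Longrightarrow> 0 \<le> q k"
    and c: "\<And>k. k \<in> I \<Longrightarrow> 0 \<le> c k" "(\<Sum>k\<in>I. c k) = 1"
    and s: "s = (\<Sum>k\<in>I. q k)" "0 < s"
  shows gibbs_le: "(\<Sum>k\<in>I. ennreal (q k) * nlog (q k / s)) \<le> (\<Sum>k\<in>I. ennreal (q k) * nlog (c k))"
      (is "?L \<le> ?R")
    and gibbs_eq: "(\<Sum>k\<in>I. ennreal (q k) * nlog (c k)) = (\<Sum>k\<in>I. ennreal (q k) * nlog (q k / s)) \<Longrightarrow>
      k \<in> I \<Longrightarrow> c k = q k / s"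
proof -
  have qs: "q k / s \<le> 1" if "k \<in> I" for k
    using s member_le_sum[OF that, of q] q I by simp
  have c1: "c k \<le> 1" if "k \<in> I" for k
    using member_le_sum[OF that, of c] c I by simp
  have L: "?L = ennreal (\<Sum>k\<in>I. q k * - ln (q k / s))" "0 \<le> (\<Sum>k\<in>I. q k * - ln (q k / s))"
    using sum_nlog_eq[of I q "\<lambda>k. q k / s"] q qs s(2) by simp_all
  have "?L \<le> ?R \<and> (?R = ?L \<longrightarrow> (\<forall>k\<in>I. c k = q k / s))"
  proof (cases "\<forall>k\<in>I. 0 < q k \<longrightarrow> 0 < c k")
    case True
    then have R: "?R = ennreal (\<Sum>k\<in>I. q k * - ln (c k))" "0 \<le> (\<Sum>k\<in>I. q k * - ln (c k))"
      using sum_nlog_eq[of I q c] q c1 by simp_all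
    let ?d = "\<lambda>k. q k * - ln (c k) - q k * - ln (q k / s)"
    have d: "q k - s * c k \<le> ?d k" and d_eq: "q k - s * c k = ?d k \<Longrightarrow> c k = q k / s"
      if k: "k \<in> I" for k
    proof -
      have "q k - s * c k \<le> ?d k \<and> (q k - s * c k = ?d k \<longrightarrow> c k = q k / s)"
      proof (cases "q k = 0")
        \<comment> \<open>The loss terms vanish and the linear bound is \<open>- s * c k\<close>, so
          equality forces \<open>c k = 0\<close>.\<close>
        case True
        then show ?thesis using c(1)[OF k] s(2) by simp
      next
        case False
        then have qk: "0 < q k" using q[OF k] by simp
        then have ck: "0 < c k" using \<open>\<forall>k\<in>I. 0 < q k \<longrightarrow> 0 < c k\<close> k by blast
        define r where "r = c k * s / q k"
        have r: "0 < r" using qk ck s(2) by (simp add: r_def)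
        have ln_c: "ln (c k) = ln r + ln (q k / s)"
          using qk ck s(2) by (simp add: r_def ln_mult ln_div)
        have dk: "?d k = q k * - ln r" unfolding ln_c by (simp add: algebra_simps)
        have lk: "q k - s * c k = q k * - (r - 1)"
          using qk by (simp add: r_def field_simps)
        have "q k * - (r - 1) \<le> q k * - ln r"
          using ln_le_minus_one[OF r] qk by (intro mult_left_mono) auto
        moreover have "c k = q k / s" if "q k * - (r - 1) = q k * - ln r"
        proof -
          have "- (r - 1) = - ln r"
            using that qk unfolding mult_cancel_left by simp
          then have "ln r = r - 1" by simp
          then have "r = 1" using r by (intro ln_eq_minus_one)
          then show ?thesis using qk s(2) by (simp add: r_def field_simps)
        qed
        ultimately show ?thesis unfolding dk lk by blast
      qed
      then show "q k - s * c k \<le> ?d k" "q k - s * c k = ?d k \<Longrightarrow> c k = q k / s" by auto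
    qed
    \<comment> \<open>The \<open>q k\<close> sum to \<open>s\<close> and the \<open>c k\<close> to
      1.\<close>
    have zero: "(\<Sum>k\<in>I. q k - s * c k) = 0"
      using s(1) c(2) by (simp add: sum_subtractf flip: sum_distrib_left)
    have "0 \<le> (\<Sum>k\<in>I. ?d k)"
      unfolding zero[symmetric] using d by (rule sum_mono)
    then have le: "?L \<le> ?R" unfolding L R by (intro ennreal_leI) (simp add: sum_subtractf sum_negf)
    have "c k = q k / s" if "?R = ?L" "k \<in> I" for k
    proof -
      have "(\<Sum>k\<in>I. q k * - ln (c k)) = (\<Sum>k\<in>I. q k * - ln (q k / s))"
        using that(1) L R by simp
      then have "(\<Sum>k\<in>I. q k - s * c k) = (\<Sum>k\<in>I. ?d k)"
        unfolding zero by (simp add: sum_subtractf sum_negf)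
      \<comment> \<open>Termwise inequalities between finite families with equal sums are
        equalities.\<close>
      then have "q k - s * c k = ?d k"
        using d that(2) I by (rule sum_mono_inv)
      with that(2) show ?thesis by (rule d_eq)
    qed
    with le show ?thesis by blast
  next
    \<comment> \<open>Some positive \<open>q k\<close> meets \<open>c k = 0\<close>: the right side
      is infinite while the left is finite, so equality is excluded as well.\<close>
    case False
    then obtain k where k: "k \<in> I" "0 < q k" "c k \<le> 0" by (auto simp: not_less)
    then have "ennreal (q k) * nlog (c k) = \<infinity>"
      by (simp add: nlog_nonpos ennreal_mult_top)
    moreover have "ennreal (q k) * nlog (c k) \<le> ?R"
      using k I by (intro member_le_sum) auto
    ultimately have "?R = \<infinity>" by (simp add: top_unique)
    then show ?thesis using L by simp
  qed
  then show "?L \<le> ?R" "?R = ?L \<Longrightarrow> k \<in> I \<Longrightarrow> c k = q k / s" by auto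
qed

section \<open>The optimal classifier on the support of the mixture\<close>

context transformed_mixture
begin

text \<open>The pointwise minimizer \<open>b\<close> is itself a classifier, so \<open>C\<close>
  cannot have a larger total loss than \<open>b\<close>. As \<open>b\<close> is also best at every
  point and its total loss is finite, the two losses agree almost everywhere, and the equality case
  of Gibbs' inequality applies.\<close>

lemma optimal_classifier_AE:
  assumes "optimal_classifier K T P C"
  shows "AE x in mixture K T P. \<forall>k\<in>{1..K}. C k x = q k x / (\<Sum>j=1..K. q j x)"
proof -
  define s where "s x = (\<Sum>j=1..K. q j x)" for x
  define u where "u k x = 1 / real K" for k :: nat and x :: 'a
  \<comment> \<open>Where \<open>s x = 0\<close> the quotient would be 0 for every \<open>k\<close>;
    the value \<open>1 / real K\<close> keeps the outputs summing to 1 there.\<close>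
  define b where "b k x = (if s x = 0 then 1 / real K else q k x / s x)" for k x
  define loss where
    "loss C' x = ennreal (1 / real K) * (\<Sum>k=1..K. ennreal (q k x) * nlog (C' k x))" for C' x
  have s_nonneg: "0 \<le> s x" for x unfolding s_def by (intro sum_nonneg pdf_nonneg)
  have s_measurable [measurable]: "s \<in> borel_measurable borel" unfolding s_def by simp
  have C: "classifier K C" and C_max: "\<And>C'. classifier K C' \<Longrightarrow> Psi K T P C' \<le> Psi K T P C"
    using assms by (auto simp: optimal_classifier_def is_arg_max_def not_less)
  have u: "classifier K u"
    using K by (auto simp: classifier_def u_def[abs_def])
  have b: "classifier K b"
    unfolding classifier_def
  proof (intro conjI ballI allI)
    fix k show "b k \<in> borel_measurable borel" unfolding b_def by measurable
    show "0 \<le> b k x" for x using s_nonneg by (simp add: b_def pdf_nonneg)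
  next
    fix x show "(\<Sum>k=1..K. b k x) = 1"
    proof (cases "s x = 0")
      case False
      then have "(\<Sum>k=1..K. b k x) = (\<Sum>k=1..K. q k x) / s x"
        by (simp add: b_def sum_divide_distrib)
      with False show ?thesis unfolding s_def[symmetric] by simp
    qed (use K in \<open>simp add: b_def\<close>)
  qed
  have loss_measurable: "loss C' \<in> borel_measurable lborel" if "classifier K C'" for C'
  proof -
    have [measurable]: "C' k \<in> borel_measurable borel" if "k \<in> {1..K}" for k
      using \<open>classifier K C'\<close> that by (simp add: classifier_def)
    show ?thesis unfolding loss_def by measurable
  qed
  have q_zero: "q k x = 0" if "s x = 0" "k \<in> {1..K}" for k x
    using that unfolding s_def by (subst (asm) sum_nonneg_eq_0_iff) (auto simp: pdf_nonneg)
  have b_best: "loss b x \<le> loss C' x" if "classifier K C'" for C' x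
  proof (cases "s x = 0")
    case False
    then have "0 < s x" using s_nonneg[of x] by simp
    then have "(\<Sum>k=1..K. ennreal (q k x) * nlog (q k x / s x)) \<le>
        (\<Sum>k=1..K. ennreal (q k x) * nlog (C' k x))"
      using that by (intro gibbs_le) (auto simp: s_def pdf_nonneg classifier_def)
    then show ?thesis using False by (auto simp: loss_def b_def intro!: mult_left_mono)
  qed (simp add: loss_def q_zero)
  \<comment> \<open>The uniform classifier has constant log loss, so its total loss is
    \<open>ln K\<close>: each transformed law has mass 1.\<close>
  have "(\<integral>\<^sup>+ x. loss u x \<partial>lborel) =
      ennreal (1 / real K) * (\<Sum>k=1..K. \<integral>\<^sup>+ x. nlog (1 / real K) \<partial>transformed T P k)"
    using ss_task_eq_transformed[OF u] ss_task_eq_lborel[OF u]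
    by (simp add: loss_def u_def enn2ereal_inject)
  also have "\<dots> = ennreal (1 / real K) * (\<Sum>k=1..K. nlog (1 / real K))"
    by (intro arg_cong2[where f = "(*)"] sum.cong refl)
      (use prob_space.emeasure_space_1[OF transformed_prob_space] in simp)
  also have "\<dots> < \<infinity>"
    using K by (simp add: nlog_pos ennreal_mult_less_top of_nat_less_top)
  finally have u_fin: "(\<integral>\<^sup>+ x. loss u x \<partial>lborel) < \<infinity>" .
  have b_fin: "(\<integral>\<^sup>+ x. loss b x \<partial>lborel) \<noteq> \<infinity>"
    using nn_integral_mono[of lborel "loss b" "loss u"] b_best[OF u] u_fin by (auto simp: top_unique)
  \<comment> \<open>\<open>Psi\<close> is the negated total loss, so maximality of \<open>C\<close>
    reverses into this bound.\<close>
  have "(\<integral>\<^sup>+ x. loss C x \<partial>lborel) \<le> (\<integral>\<^sup>+ x. loss b x \<partial>lborel)"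
    using C_max[OF b] unfolding Psi_def ss_task_eq_lborel[OF b] ss_task_eq_lborel[OF C]
    by (simp add: loss_def less_eq_ennreal.rep_eq)
  then have "(\<integral>\<^sup>+ x. loss C x - loss b x \<partial>lborel) = 0"
    using nn_integral_diff[OF loss_measurable[OF C] loss_measurable[OF b] b_fin] b_best[OF C]
      b_fin
    by (auto simp: diff_eq_0_iff_ennreal less_top intro: le_less_trans)
  then have "AE x in lborel. loss C x - loss b x = 0"
    using loss_measurable[OF C] loss_measurable[OF b] by (subst (asm) nn_integral_0_iff_AE) auto
  moreover have "AE x in lborel. loss b x \<noteq> \<infinity>"
    using nn_integral_PInf_AE[OF loss_measurable[OF b] b_fin] .
  \<comment> \<open>The guard is positivity of the mixture density, which turns this into a
    statement almost everywhere in the mixture.\<close>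
  ultimately have "AE x in lborel. 0 < ennreal (s x / real K) \<longrightarrow>
      (\<forall>k\<in>{1..K}. C k x = q k x / s x)"
  proof eventually_elim
    case (elim x)
    show ?case
    proof (intro impI ballI)
      fix k assume k: "k \<in> {1..K}" and "0 < ennreal (s x / real K)"
      then have s: "0 < s x" using K by (simp add: ennreal_less_zero_iff zero_less_divide_iff)
      have "loss C x = loss b x"
        using elim b_best[OF C, of x] by (metis diff_eq_0_iff_ennreal antisym)
      then have "(\<Sum>k=1..K. ennreal (q k x) * nlog (C k x)) =
          (\<Sum>k=1..K. ennreal (q k x) * nlog (q k x / s x))"
        using s K by (simp add: loss_def b_def ennreal_mult_cancel_left)
      then show "C k x = q k x / s x"
        using C s k by (intro gibbs_eq[of "{1..K}" "\<lambda>k. q k x"]) (auto simp: s_def pdf_nonneg classifier_def)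
    qed
  qed
  then show ?thesis
    by (subst density_mixture[symmetric]) (simp add: AE_density s_def)
qed

end

section \<open>The generator's task at an optimal classifier\<close>

theorem theorem1:
  fixes K :: nat
    and T :: "nat \<Rightarrow> 'a::euclidean_space \<Rightarrow> 'a"
    and Pd :: "'a measure"
    and Z :: "'z measure"
    and Gs :: "('z \<Rightarrow> 'a) set"
    and Cstar :: "nat \<Rightarrow> 'a \<Rightarrow> real"
  assumes "1 \<le> K"
    and "\<And>k. k \<in> {1..K} \<Longrightarrow> T k \<in> measurable borel borel"
    and "prob_space Pd" and "sets Pd = sets borel"
    and "\<And>k. k \<in> {1..K} \<Longrightarrow> has_pdf (transformed T Pd k)"
    and "prob_space Z"
    and "\<And>G. G \<in> Gs \<Longrightarrow> admissible_generator K T Pd Z G"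
    and "optimal_classifier K T Pd Cstar"
  shows "(\<forall>G\<in>Gs. Phi K T Z G Cstar = ereal (1 / real K) * (\<Sum>k=1..K. V_Phi K T Pd Z G k)) \<and>
         (\<forall>G. is_arg_max (\<lambda>G. Phi K T Z G Cstar) (\<lambda>G. G \<in> Gs) G \<longleftrightarrow>
              is_arg_max (\<lambda>G. ereal (1 / real K) * (\<Sum>k=1..K. V_Phi K T Pd Z G k)) (\<lambda>G. G \<in> Gs) G)"
proof -
  interpret d: transformed_mixture K T Pd
    by (intro transformed_mixture.intro assms)
  have C: "classifier K Cstar"
    using assms(8) by (simp add: optimal_classifier_def is_arg_max_def)
  have eq: "Phi K T Z G Cstar = ereal (1 / real K) * (\<Sum>k=1..K. V_Phi K T Pd Z G k)"
    if "G \<in> Gs" for G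
  proof -
    have G: "G \<in> measurable Z borel" "\<And>k. k \<in> {1..K} \<Longrightarrow> has_pdf (transformed T (generated Z G) k)"
      and ac: "absolutely_continuous (mixture K T Pd) (mixture K T (generated Z G))"
      using assms(7)[OF that] by (auto simp: admissible_generator_def)
    interpret g: transformed_mixture K T "generated Z G"
      using assms(1,2) G prob_space.prob_space_distr[OF assms(6) G(1)]
      by (intro transformed_mixture.intro) (auto simp: generated_def)
    \<comment> \<open>Absolute continuity carries null sets of the data mixture to null sets of the
      generated mixture.\<close>
    have AE: "AE x in mixture K T (generated Z G). \<forall>k\<in>{1..K}. Cstar k x = d.q k x / (\<Sum>j=1..K. d.q j x)"
      using d.optimal_classifier_AE[OF assms(8)]
      by (rule absolutely_continuous_AE[OF _ ac, rotated]) (simp add: mixture_def)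
    have V: "V_Phi K T Pd Z G k =
        - enn2ereal (\<integral>\<^sup>+ x. nlog (Cstar k x) \<partial>transformed T (generated Z G) k)" if k: "k \<in> {1..K}" for k
    proof -
      \<comment> \<open>The identity passes from the generated mixture to its \<open>k\<close>-th
        component; the ratio may then be replaced by \<open>Cstar k x\<close>, which is at most
        1.\<close>
      have "AE x in transformed T (generated Z G) k.
          elog (d.q k x / (\<Sum>j=1..K. d.q j x)) = - enn2ereal (nlog (Cstar k x))"
        using g.AE_transformed_of_mixture[OF AE k]
      proof eventually_elim
        case (elim x)
        then show ?case
          using k elog_eq_nlog[OF classifier_le_1[OF C k], of x] by simp
      qed
      then show ?thesis
        unfolding V_Phi_def by (simp add: eintegral_cong_AE eintegral_uminus_enn2ereal)
    qed
    then have "(\<Sum>k=1..K. V_Phi K T Pd Z G k) =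
        - enn2ereal (\<Sum>k=1..K. \<integral>\<^sup>+ x. nlog (Cstar k x) \<partial>transformed T (generated Z G) k)"
      by (simp add: sum_uminus_enn2ereal)
    then show ?thesis
      unfolding Phi_def g.ss_task_eq_transformed[OF C]
      by (simp only: mult_uminus_enn2ereal divide_nonneg_nonneg of_nat_0_le_iff zero_le_one)
  qed
  \<comment> \<open>The two objectives coincide on all of \<open>Gs\<close>, hence have the same
    maximizers there.\<close>
  then show ?thesis by (auto simp: is_arg_max_def)
qed

end
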